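(* Let $G=HV\leqslant \mathrm{AGL}(V)$ be a finite affine primitive permutation group with point stabilizer $H=G_0$ (the stabilizer of the zero vector) and socle $V=(\mathbb{Z}_p)^k$, where $p$ is a prime and $k\geqslant 1$. Let $r$ be a prime. Then every derangement in $G$ is an $r$-element if and only if $r=p$ and the pair $(H,V)$ is $r'$-semiregular.
   Context: A derangement in a permutation group is an element with no fixed points (here, on the set $V$). An $r$-element is an element of $r$-power order; an $r'$-element is an element whose order is not divisible by $r$. For a finite group $H\leqslant \mathrm{GL}(V)$, the pair $(H,V)$ is $r'$-semiregular if every nontrivial $r'$-element of $H$ has no fixed points on $V\setminus\{0\}$ (equivalently, no nontrivial $r'$-element of $H$ has eigenvalue $1$ on $V$). *)

theory Defs
  imports
    "HOL-Analysis.Cartesian_Space"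
    "HOL-Algebra.Group_Action"
    "HOL-Algebra.Generated_Groups"
    "HOL-Algebra.Multiplicative_Group"
    "Berlekamp_Zassenhaus.Finite_Field"
begin

text \<open>The vector space \<open>(\<int>/p)\<^sup>k\<close> is the type \<open>'p mod_ring ^ 'k\<close> with
  \<open>'p :: prime_card\<close> and \<open>'k :: finite\<close>. The prime \<open>p\<close> is \<open>CARD('p)\<close> and \<open>k\<close> is
  \<open>CARD('k)\<close>, so that \<open>k \<ge> 1\<close> is built in.\<close>

text \<open>The group with carrier \<open>K\<close> inside the symmetric group on the underlying type;
  \<open>BijGroup UNIV\<close> has all bijections as carrier, composition as multiplication and the
  identity map as unit.\<close>

definition perm_group :: "('v \<Rightarrow> 'v) set \<Rightarrow> ('v \<Rightarrow> 'v) monoid" where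
  "perm_group K = (BijGroup UNIV)\<lparr>carrier := K\<rparr>"

definition translation_maps :: "('v::ab_group_add \<Rightarrow> 'v) set" where
  "translation_maps = {\<lambda>x. x + v | v. True}"

definition GL :: "('a::field ^ 'n \<Rightarrow> 'a ^ 'n) set" where
  "GL = {h. Vector_Spaces.linear (*s) (*s) h \<and> bij h}"

definition AGL :: "('a::field ^ 'n \<Rightarrow> 'a ^ 'n) set" where
  "AGL = {\<lambda>x. h x + v | h v. h \<in> GL}"

text \<open>An action is primitive if it is transitive and every block is a singleton or the
  whole set.\<close>

definition primitive_action ::
    "('g, 'c) monoid_scheme \<Rightarrow> 'v set \<Rightarrow> ('g \<Rightarrow> 'v \<Rightarrow> 'v) \<Rightarrow> bool" where
  "primitive_action G E \<phi> \<longleftrightarrow>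
     transitive_action G E \<phi> \<and>
     (\<forall>B. B \<subseteq> E \<and> B \<noteq> {} \<and>
          (\<forall>g\<in>carrier G. \<phi> g ` B = B \<or> \<phi> g ` B \<inter> B = {})
        \<longrightarrow> is_singleton B \<or> B = E)"

definition minimal_normal :: "'g set \<Rightarrow> ('g, 'c) monoid_scheme \<Rightarrow> bool" where
  "minimal_normal N G \<longleftrightarrow>
     N \<lhd> G \<and> N \<noteq> {\<one>\<^bsub>G\<^esub>} \<and>
     (\<forall>M. M \<lhd> G \<and> M \<subseteq> N \<and> M \<noteq> {\<one>\<^bsub>G\<^esub>} \<longrightarrow> M = N)"

definition socle :: "('g, 'c) monoid_scheme \<Rightarrow> 'g set" where
  "socle G = generate G (\<Union>{N. minimal_normal N G})"

text \<open>The vector space is identified with its group of translations, which is required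
  to be the socle.\<close>

definition affine_primitive :: "('a::field ^ 'n \<Rightarrow> 'a ^ 'n) set \<Rightarrow> bool" where
  "affine_primitive G \<longleftrightarrow>
     subgroup G (BijGroup UNIV) \<and> G \<subseteq> AGL \<and>
     primitive_action (perm_group G) UNIV (\<lambda>g. g) \<and>
     socle (perm_group G) = translation_maps"

definition derangement :: "('v \<Rightarrow> 'v) \<Rightarrow> bool" where
  "derangement g \<longleftrightarrow> (\<forall>x. g x \<noteq> x)"

definition r_element :: "nat \<Rightarrow> ('g, 'c) monoid_scheme \<Rightarrow> 'g \<Rightarrow> bool" where
  "r_element r G g \<longleftrightarrow> g \<in> carrier G \<and> (\<exists>n. group.ord G g = r ^ n)"

definition r'_element :: "nat \<Rightarrow> ('g, 'c) monoid_scheme \<Rightarrow> 'g \<Rightarrow> bool" where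
  "r'_element r G g \<longleftrightarrow> g \<in> carrier G \<and> \<not> r dvd group.ord G g"

definition r'_semiregular :: "nat \<Rightarrow> ('v::zero \<Rightarrow> 'v) set \<Rightarrow> bool" where
  "r'_semiregular r H \<longleftrightarrow>
     (\<forall>h. r'_element r (perm_group H) h \<and> h \<noteq> id \<longrightarrow> (\<forall>v. v \<noteq> 0 \<longrightarrow> h v \<noteq> v))"

end

theory Submission
  imports Defs
begin

text \<open>An affine map of finite order prime to \<open>p\<close> fixes the barycentre of an orbit. So if all
  nontrivial \<open>p'\<close>-elements of \<open>H\<close> act fixed point freely on \<open>V \<setminus> {0}\<close>, then the
  nontrivial \<open>p'\<close>-part of an element \<open>g\<close> of order not a \<open>p\<close>-power has exactly one fixed point,
  and \<open>g\<close>, which commutes with it, fixes that point too. Conversely, nonzero translations are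
  derangements of order \<open>p\<close>; and if a nontrivial \<open>p'\<close>-element \<open>h\<close> fixes \<open>v \<noteq> 0\<close>, then
  \<open>x \<mapsto> h x + v\<close> is a derangement whose order is not a power of \<open>p\<close>.\<close>

lemma group_perm_group:
  "subgroup K (BijGroup UNIV) \<Longrightarrow> group (perm_group K)"
  unfolding perm_group_def by (rule subgroup.subgroup_is_group[OF _ group_BijGroup])

lemma carrier_perm_group [simp]: "carrier (perm_group K) = K"
  by (simp add: perm_group_def)

lemma one_perm_group [simp]: "\<one>\<^bsub>perm_group K\<^esub> = id"
  by (auto simp: perm_group_def BijGroup_def)

lemma mult_BijGroup_UNIV:
  "f \<in> carrier (BijGroup UNIV) \<Longrightarrow> g \<in> carrier (BijGroup UNIV) \<Longrightarrow>
    f \<otimes>\<^bsub>BijGroup UNIV\<^esub> g = f \<circ> g"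
  by (auto simp: BijGroup_def compose_def)

lemma mult_perm_group:
  assumes "subgroup K (BijGroup UNIV)" "f \<in> K" "g \<in> K"
  shows "f \<otimes>\<^bsub>perm_group K\<^esub> g = f \<circ> g"
  using assms subgroup.subset[OF assms(1)]
  by (auto simp: perm_group_def intro!: mult_BijGroup_UNIV)

lemma comp_mem:
  assumes "subgroup K (BijGroup UNIV)" "f \<in> K" "g \<in> K"
  shows "f \<circ> g \<in> K"
  using group.is_monoid[OF group_perm_group[OF assms(1)]] assms
  by (metis carrier_perm_group monoid.m_closed mult_perm_group)

lemma pow_perm_group:
  assumes "subgroup K (BijGroup UNIV)" "g \<in> K"
  shows "g [^]\<^bsub>perm_group K\<^esub> n = g ^^ n \<and> g ^^ n \<in> K"
proof (induction n)
  case 0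
  show ?case using group.is_monoid[OF group_perm_group[OF assms(1)]]
    by (metis carrier_perm_group funpow_0 eq_id_iff monoid.nat_pow_0 monoid.one_closed one_perm_group)
next
  case (Suc n)
  then show ?case
    using mult_perm_group[OF assms(1), of "g ^^ n" g] comp_mem[OF assms(1), of "g ^^ n" g] assms(2)
    by (simp add: nat_pow_def funpow_Suc_right comp_def del: funpow.simps)
qed

text \<open>Function powers do not mention the group, so through them orders taken in
  \<open>perm_group G\<close> and in \<open>perm_group H\<close> can be compared.\<close>

lemma funpow_eq_id_iff_ord_dvd:
  assumes "subgroup K (BijGroup UNIV)" "g \<in> K"
  shows "g ^^ n = id \<longleftrightarrow> group.ord (perm_group K) g dvd n"
  using group.pow_eq_id[OF group_perm_group[OF assms(1)], of g n] assms pow_perm_group[OF assms]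
  by auto

lemma of_nat_mod_ring_eq_0_iff:
  "(of_nat n :: 'p::prime_card mod_ring) = 0 \<longleftrightarrow> CARD('p) dvd n"
  using of_nat_0_mod_ring_dvd[where 'a = 'p] by (auto elim!: dvdE)

lemma translation_funpow:
  fixes v :: "'a::field ^ 'n"
  shows "((\<lambda>x. x + v) ^^ n) x = x + of_nat n *s v"
  by (induction n) (simp_all add: vector_sadd_rdistrib algebra_simps)

lemma affine_funpow_fixed_point:
  fixes f :: "'a::field ^ 'n \<Rightarrow> 'a ^ 'n"
  assumes L: "Vector_Spaces.linear (*s) (*s) L" and f: "\<And>x. f x = L x + w"
    and m: "f ^^ m = id" "of_nat m \<noteq> (0 :: 'a)"
  shows "\<exists>x. f x = x"
proof -
  interpret Vector_Spaces.linear "(*s)" "(*s)" L by (rule L)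
  \<comment> \<open>The orbit of \<open>0\<close>, run through for \<open>m\<close> steps; its
    barycentre is \<open>c\<close> divided by \<open>m\<close>, which makes sense because
    \<open>m\<close> is nonzero in the field.\<close>
  define c where "c = (\<Sum>i<m. (f ^^ i) 0)"
  have "L c = (\<Sum>i<m. (f ^^ Suc i) 0 - w)"
    by (simp add: c_def sum f)
  also have "\<dots> = (\<Sum>i<m. (f ^^ Suc i) 0) - of_nat m *s w"
    by (simp add: sum_subtractf vec_eq_iff of_nat_index)
  \<comment> \<open>The shift trades the term for index 0 for the term for index \<open>m\<close>,
    and these agree since \<open>f ^^ m = id\<close>.\<close>
  also have "(\<Sum>i<m. (f ^^ Suc i) 0) = c"
    using sum.lessThan_Suc_shift[of "\<lambda>i. (f ^^ i) 0" m] m(1)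
    by (simp add: c_def)
  finally have "L c = c - of_nat m *s w" .
  then have "f (inverse (of_nat m) *s c) = inverse (of_nat m) *s c"
    using m(2) by (simp add: f scale vector_ssub_ldistrib)
  then show ?thesis by blast
qed

lemma AGL_E:
  assumes "f \<in> AGL"
  obtains L w where "Vector_Spaces.linear (*s) (*s) L" "\<And>x. f x = L x + w"
  using assms by (auto simp: AGL_def GL_def)

theorem theorem4:
  fixes G H :: "('p::prime_card mod_ring ^ 'k \<Rightarrow> 'p mod_ring ^ 'k) set"
    and r :: nat
  assumes "affine_primitive G"
    and "H = stabilizer (perm_group G) (\<lambda>g. g) 0"
    and "G = H <#>\<^bsub>BijGroup UNIV\<^esub> translation_maps"
    and "prime r"
  shows "(\<forall>g\<in>G. derangement g \<longrightarrow> r_element r (perm_group G) g) \<longleftrightarrow>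
         r = CARD('p) \<and> r'_semiregular r H"
proof -
  let ?ord = "group.ord (perm_group G)"
  have sub: "subgroup G (BijGroup UNIV)" and AGL: "G \<subseteq> AGL"
    using assms(1) by (auto simp: affine_primitive_def)
  interpret group "perm_group G" by (rule group_perm_group[OF sub])
  have H: "h \<in> H \<longleftrightarrow> h \<in> G \<and> h 0 = 0" for h
    by (auto simp: assms(2) stabilizer_def)
  have "group_action (perm_group G) UNIV (\<lambda>g. g)"
    using assms(1) by (auto simp: affine_primitive_def primitive_action_def transitive_action_def)
  then have "subgroup H (perm_group G)"
    unfolding assms(2) by (intro group_action.stabilizer_subgroup) auto
  then have subH: "subgroup H (BijGroup UNIV)"
    using group.incl_subgroup[OF group_BijGroup sub] by (simp add: perm_group_def)
  have "id \<in> H"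
    using one_closed by (simp add: H)
  have trans: "(\<lambda>x. x + v) \<in> G" for v
  proof -
    have bij: "(\<lambda>x. x + v) \<in> carrier (BijGroup UNIV)"
      using bij_plus_right[of v] by (simp add: BijGroup_def Bij_def)
    have "id \<otimes>\<^bsub>BijGroup UNIV\<^esub> (\<lambda>x. x + v) \<in> G"
      unfolding assms(3) set_mult_def using \<open>id \<in> H\<close> by (auto simp: translation_maps_def)
    then show ?thesis
      using mult_BijGroup_UNIV[OF _ bij, of id] subgroup.mem_carrier[OF subH \<open>id \<in> H\<close>]
      by simp
  qed
  have pow: "g ^^ n = id \<longleftrightarrow> ?ord g dvd n" if "g \<in> G" for g n
    using funpow_eq_id_iff_ord_dvd[OF sub that] .
  have powH: "g ^^ n = id \<longleftrightarrow> group.ord (perm_group H) g dvd n" if "g \<in> H" for g n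
    using funpow_eq_id_iff_ord_dvd[OF subH that] .
  have prime_p: "prime CARD('p)" by (rule prime_card)
  show ?thesis
  proof (intro iffI conjI)
    assume der: "\<forall>g\<in>G. derangement g \<longrightarrow> r_element r (perm_group G) g"
    \<comment> \<open>Here \<open>1\<close> is the all-ones vector, a convenient nonzero
      one.\<close>
    define t where "t = (\<lambda>x :: 'p mod_ring ^ 'k. x + 1)"
    have "t \<in> G" unfolding t_def by (rule trans)
    have "(1 :: 'p mod_ring ^ 'k) \<noteq> 0" by (simp add: vec_eq_iff)
    then have "derangement t" by (simp add: derangement_def t_def)
    then obtain n where n: "?ord t = r ^ n"
      using der \<open>t \<in> G\<close> by (auto simp: r_element_def)
    have "t ^^ CARD('p) = id"
      unfolding t_def by (auto simp: translation_funpow of_nat_mod_ring_eq_0_iff)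
    then have "r ^ n dvd CARD('p)" using pow[OF \<open>t \<in> G\<close>] n by metis
    moreover have "n \<noteq> 0"
    proof
      assume "n = 0"
      then have "t ^^ 1 = id" using pow[OF \<open>t \<in> G\<close>] n by simp
      then show False using \<open>1 \<noteq> 0\<close> by (simp add: t_def fun_eq_iff)
    qed
    ultimately have "r dvd CARD('p)" by (metis dvd_power dvd_trans neq0_conv)
    then show r: "r = CARD('p)" using assms(4) prime_p primes_dvd_imp_eq by blast
    show "r'_semiregular r H"
      unfolding r'_semiregular_def
    proof (intro allI impI notI)
      fix h v
      assume h: "r'_element r (perm_group H) h \<and> h \<noteq> id" and "v \<noteq> 0" and hv: "h v = v"
      define m where "m = group.ord (perm_group H) h"
      have "h \<in> H" and m: "\<not> r dvd m" using h by (auto simp: r'_element_def m_def)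
      then have "h \<in> G" "h 0 = 0" by (auto simp: H)
      then obtain L w where L: "Vector_Spaces.linear (*s) (*s) L" and hL: "\<And>x. h x = L x + w"
        using AGL AGL_E by blast
      interpret L: Vector_Spaces.linear "(*s)" "(*s)" L by (rule L)
      \<comment> \<open>Fixing \<open>0\<close> makes \<open>h\<close> equal to its linear part, so
        the facts of the interpretation \<open>L\<close> apply to \<open>h\<close>.\<close>
      have "w = 0" using \<open>h 0 = 0\<close> by (simp add: hL)
      then have [simp]: "L = h" using hL by (simp add: fun_eq_iff)
      have hm: "h ^^ m = id" using powH[OF \<open>h \<in> H\<close>] by (simp add: m_def)
      define g where "g = (\<lambda>x. x + v) \<circ> h"
      have "g \<in> G" unfolding g_def by (rule comp_mem[OF sub trans \<open>h \<in> G\<close>])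
      \<comment> \<open>Since \<open>h\<close> is linear and fixes \<open>v\<close>, it commutes
        with translation by \<open>v\<close>; the two factors of \<open>g\<close> can be raised to
        powers separately.\<close>
      have gpow: "(g ^^ n) x = (h ^^ n) x + of_nat n *s v" for n x
        using L.add L.scale hv
        by (induction n) (simp_all add: g_def vector_sadd_rdistrib algebra_simps)
      have m0: "of_nat m \<noteq> (0 :: 'p mod_ring)" using m r of_nat_mod_ring_eq_0_iff by metis
      \<comment> \<open>By \<open>gpow\<close>, \<open>g ^^ m\<close> is translation by
        \<open>m\<close> times \<open>v\<close>. It moves every point, so \<open>g\<close> does
        too.\<close>
      have "derangement g"
        unfolding derangement_def
      proof (intro allI notI)
        fix x assume "g x = x"
        then have "(g ^^ m) x = x" by (induction m) simp_all
        then have "of_nat m *s v = 0" using gpow[of m x] hm by simp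
        then show False using m0 \<open>v \<noteq> 0\<close> by (auto simp: vec_eq_iff)
      qed
      then obtain n where "?ord g = r ^ n"
        using der \<open>g \<in> G\<close> by (auto simp: r_element_def)
      then have gn: "g ^^ r ^ n = id" using pow[OF \<open>g \<in> G\<close>] by simp
      \<comment> \<open>For \<open>n > 0\<close> the translation part of \<open>g ^^ r ^ n\<close>
        vanishes because p divides \<open>r ^ n\<close>. For \<open>n = 0\<close> it does not, but
        then \<open>g = id\<close>, against \<open>g 0 = v\<close>.\<close>
      have "h ^^ r ^ n = id"
      proof (cases n)
        case 0
        then have "g = id" using gn by (simp add: fun_eq_iff)
        then have "g 0 = 0" by simp
        then show ?thesis using \<open>v \<noteq> 0\<close> \<open>h 0 = 0\<close> by (simp add: g_def)
      next
        case (Suc k)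
        then have "of_nat (r ^ n) = (0 :: 'p mod_ring)"
          using r of_nat_mod_ring_eq_0_iff[where 'p = 'p, of "r ^ n"] by simp
        then show ?thesis using gn gpow[of "r ^ n"] by (simp add: fun_eq_iff del: of_nat_power)
      qed
      then have "m dvd r ^ n" using powH[OF \<open>h \<in> H\<close>] by (simp add: m_def)
      then have "m = 1" using m assms(4)
        by (metis coprime_absorb_left coprime_power_right_iff prime_imp_coprime_nat coprime_commute
            is_unit_gcd nat_dvd_1_iff_1)
      then show False using hm h by simp
    qed
  next
    assume "r = CARD('p) \<and> r'_semiregular r H"
    then have r: "r = CARD('p)" and semi: "r'_semiregular r H" by auto
    show "\<forall>g\<in>G. derangement g \<longrightarrow> r_element r (perm_group G) g"
    proof (intro ballI impI, rule ccontr)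
      fix g assume "g \<in> G" and der: "derangement g" and not_r: "\<not> r_element r (perm_group G) g"
      \<comment> \<open>Rules out the value 0 of \<open>ord\<close>, from which no power of
        \<open>r\<close> could be split off.\<close>
      have "finite G" by (rule finite)
      then have "?ord g \<noteq> 0" using ord_ge_1[of g] \<open>g \<in> G\<close> by simp
      then obtain a m where am: "?ord g = r ^ a * m" "\<not> r dvd m"
        using prime_power_canonical[OF assms(4), of "?ord g"] by (auto simp: mult.commute)
      then have "m \<noteq> 1" using not_r \<open>g \<in> G\<close> by (auto simp: r_element_def)
      \<comment> \<open>This power removes the \<open>r\<close>-part of \<open>g\<close>: what is
        left is nontrivial and has order dividing \<open>m\<close>, hence prime to
        \<open>r\<close>.\<close>
      define s where "s = g ^^ r ^ a"
      have "s \<in> G" unfolding s_def using pow_perm_group[OF sub \<open>g \<in> G\<close>] by blast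
      have sm: "s ^^ m = id"
        unfolding s_def funpow_mult using pow[OF \<open>g \<in> G\<close>] am(1) by (simp add: mult.commute)
      have "s \<noteq> id"
      proof
        assume "s = id"
        then have "r ^ a * m dvd r ^ a * 1" using pow[OF \<open>g \<in> G\<close>] am(1) by (simp add: s_def)
        then show False using \<open>m \<noteq> 1\<close> prime_gt_0_nat[OF assms(4)]
            dvd_mult_cancel[of "r ^ a" m 1] by simp
      qed
      obtain L w where L: "Vector_Spaces.linear (*s) (*s) L" and sL: "\<And>x. s x = L x + w"
        using AGL AGL_E \<open>s \<in> G\<close> by blast
      have "of_nat m \<noteq> (0 :: 'p mod_ring)" using am(2) r of_nat_mod_ring_eq_0_iff by metis
      then obtain x where x: "s x = x"
        using affine_funpow_fixed_point[OF L sL sm] by blast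
      \<comment> \<open>Conjugation by a translation carries the fixed point \<open>x\<close> of
        \<open>s\<close> to \<open>0\<close>, which puts the conjugate into
        \<open>H\<close>.\<close>
      define h where "h = (\<lambda>y. y + - x) \<circ> (s \<circ> (\<lambda>y. y + x))"
      have h: "h y = s (y + x) - x" for y by (simp add: h_def)
      have "h \<in> G" unfolding h_def by (intro comp_mem[OF sub] trans \<open>s \<in> G\<close>)
      then have "h \<in> H" by (simp add: H h x)
      have "(h ^^ n) y = (s ^^ n) (y + x) - x" for n y
        by (induction n) (simp_all add: h)
      then have "h ^^ m = id" using sm by (simp add: fun_eq_iff)
      then have "group.ord (perm_group H) h dvd m" using powH[OF \<open>h \<in> H\<close>] by simp
      then have "r'_element r (perm_group H) h"
        using am(2) \<open>h \<in> H\<close> by (auto simp: r'_element_def)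
      moreover have "h \<noteq> id"
      proof
        assume "h = id"
        then have "s y = y" for y using h[of "y - x"] by simp
        then show False using \<open>s \<noteq> id\<close> by (simp add: fun_eq_iff)
      qed
      ultimately have free: "v \<noteq> 0 \<Longrightarrow> h v \<noteq> v" for v
        using semi by (simp add: r'_semiregular_def)
      \<comment> \<open>As \<open>g\<close> commutes with its power \<open>s\<close>, it maps fixed
        points of \<open>s\<close> to fixed points of \<open>s\<close>.\<close>
      have "s (g x) = g x" using x by (metis s_def funpow_swap1)
      then have "h (g x - x) = g x - x" by (simp add: h)
      then have "g x = x" using free[of "g x - x"] by auto
      then show False using der by (simp add: derangement_def)
    qed
  qed
qed

end
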